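(* Let $X\subset\mathbb{R}^2$ be a non-empty bounded convex domain. Then the $2$-dimensional Hilbert geometry $(X,d)$ can be coarsely embedded into a Hilbert space.
   Context: Hilbert geometry: for a non-empty bounded convex domain (open set) $X\subset\mathbb{R}^n$, $n\ge 2$, and distinct $x,y\in X$, the line through $x$ and $y$ meets $\partial X=\overline X\setminus X$ in exactly two points $x',y'$, labelled so that $x',x,y,y'$ are in this order; set $d(x,y)=\log\frac{|xy'||yx'|}{|xx'||yy'|}$ ($|\cdot\,\cdot|$ is Euclidean distance) and $d(x,x)=0$. This is the Hilbert metric and $(X,d)$ is the ($n$-dimensional) Hilbert geometry. Coarse embedding: a map $F:Y\to H$ from a metric space $(Y,d_Y)$ to a Hilbert space $H$ is a coarse embedding if there are non-decreasing functions $\rho_-,\rho_+:[0,\infty)\to[0,\infty)$ with $\rho_-(t)\to\infty$ as $t\to\infty$ and $\rho_-(d_Y(x,y))\le\|F(x)-F(y)\|\le\rho_+(d_Y(x,y))$ for all $x,y\in Y$. *)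

theory Defs
  imports "HOL-Analysis.Analysis"
begin

section \<open>The Hilbert metric of a bounded convex domain\<close>

text \<open>
  The boundary point of \<open>X\<close> on the line through \<open>x\<close> and \<open>y\<close> that lies beyond \<open>y\<close>. In the usual
  notation, with \<open>x', x, y, y'\<close> in this order on the line, \<open>y'\<close> is \<open>chord_end X x y\<close> and \<open>x'\<close> is
  \<open>chord_end X y x\<close>. It is well defined by \<open>chord_end_unique\<close> below.
\<close>

definition chord_end :: "'a::euclidean_space set \<Rightarrow> 'a \<Rightarrow> 'a \<Rightarrow> 'a" where
  "chord_end X x y = (THE p. p \<in> closure X - X \<and> y \<in> open_segment x p)"

definition Hilbert_metric :: "'a::euclidean_space set \<Rightarrow> 'a \<Rightarrow> 'a \<Rightarrow> real" where
  "Hilbert_metric X x y =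
     (if x = y then 0
      else let x' = chord_end X y x; y' = chord_end X x y
           in ln ((dist x y' * dist y x') / (dist x x' * dist y y')))"

lemma beyond_iff:
  fixes x y p :: "'a::euclidean_space"
  assumes "x \<noteq> y"
  shows "y \<in> open_segment x p \<longleftrightarrow> (\<exists>t>0. p = y + t *\<^sub>R (y - x))"
proof
  assume "y \<in> open_segment x p"
  then obtain u where u: "0 < u" "u < 1" "y = (1 - u) *\<^sub>R x + u *\<^sub>R p"
    by (auto simp: in_segment)
  have "(1 / u - 1) *\<^sub>R (y - x) = (1 / u) *\<^sub>R ((1 - u) *\<^sub>R (y - x))"
    using u(1) by (simp only: scaleR_scaleR) (simp add: diff_divide_distrib)
  also have "(1 - u) *\<^sub>R (y - x) = u *\<^sub>R (p - y)"
    by (subst (1 2) u(3)) (simp add: algebra_simps)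
  also have "(1 / u) *\<^sub>R (u *\<^sub>R (p - y)) = p - y"
    using u(1) by simp
  finally have "p = y + (1 / u - 1) *\<^sub>R (y - x)"
    by (metis diff_add_cancel add.commute)
  then show "\<exists>t>0. p = y + t *\<^sub>R (y - x)"
    using u by (intro exI[of _ "1 / u - 1"]) auto
next
  assume "\<exists>t>0. p = y + t *\<^sub>R (y - x)"
  then obtain t where t: "t > 0" "p = y + t *\<^sub>R (y - x)" by blast
  have "x \<noteq> p"
  proof
    assume "x = p"
    then have "(1 + t) *\<^sub>R (y - x) = 0" using t by (simp add: algebra_simps)
    then show False using assms t by simp
  qed
  moreover have "y = (1 - 1 / (1 + t)) *\<^sub>R x + (1 / (1 + t)) *\<^sub>R p"
  proof -
    have "(1 - 1 / (1 + t)) *\<^sub>R x + (1 / (1 + t)) *\<^sub>R p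
        = x + (1 / (1 + t)) *\<^sub>R (p - x)"
      by (simp add: algebra_simps)
    also have "p - x = (1 + t) *\<^sub>R (y - x)"
      using t by (simp add: algebra_simps)
    finally show ?thesis using t by simp
  qed
  moreover have "0 < 1 / (1 + t)" "1 / (1 + t) < 1"
    using t by simp_all
  ultimately show "y \<in> open_segment x p"
    unfolding in_segment by blast
qed

lemma chord_end_unique:
  fixes X :: "'a::euclidean_space set"
  assumes "open X" "convex X" "bounded X" "x \<in> X" "y \<in> X" "x \<noteq> y"
  shows "\<exists>!p. p \<in> closure X - X \<and> y \<in> open_segment x p"
proof (rule ex_ex1I)
  have "y \<in> interior X" using assms by (simp add: interior_open)
  then obtain d where "0 < d" "y + d *\<^sub>R (y - x) \<in> frontier X"
    using ray_to_frontier[OF \<open>bounded X\<close>, of y "y - x"] assms by auto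
  then show "\<exists>p. p \<in> closure X - X \<and> y \<in> open_segment x p"
    using assms by (auto simp: beyond_iff frontier_def interior_open)
next
  fix p q
  assume p: "p \<in> closure X - X \<and> y \<in> open_segment x p"
    and q: "q \<in> closure X - X \<and> y \<in> open_segment x q"
  have *: False
    if "y + s *\<^sub>R (y - x) \<in> closure X - X" "y + t *\<^sub>R (y - x) \<in> closure X" "0 < s" "s < t" for s t
  proof -
    have "y + s *\<^sub>R (y - x) = (1 - s / t) *\<^sub>R y + (s / t) *\<^sub>R (y + t *\<^sub>R (y - x))"
      using that by (simp add: algebra_simps)
    moreover have "y \<noteq> y + t *\<^sub>R (y - x)" "0 < s / t" "s / t < 1"
      using that assms by simp_all
    ultimately have "y + s *\<^sub>R (y - x) \<in> open_segment y (y + t *\<^sub>R (y - x))"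
      unfolding in_segment by blast
    then show False
      using in_interior_closure_convex_segment[OF \<open>convex X\<close> _ that(2), of y] that(1) assms
      by (auto simp: interior_open)
  qed
  obtain s t where st: "0 < s" "0 < t" "p = y + s *\<^sub>R (y - x)" "q = y + t *\<^sub>R (y - x)"
    using p q assms by (auto simp: beyond_iff)
  then have "s = t"
    using *[of s t] *[of t s] p q by (metis DiffD1 linorder_neqE_linordered_idom)
  then show "p = q" using st by simp
qed

lemma chord_end:
  fixes X :: "'a::euclidean_space set"
  assumes "open X" "convex X" "bounded X" "x \<in> X" "y \<in> X" "x \<noteq> y"
  shows "chord_end X x y \<in> closure X - X" "y \<in> open_segment x (chord_end X x y)"
  using theI'[OF chord_end_unique[OF assms]] unfolding chord_end_def by blast+

lemma line_Int_boundary: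
  fixes X :: "'a::euclidean_space set"
  assumes "open X" "convex X" "bounded X" "x \<in> X" "y \<in> X" "x \<noteq> y"
  shows "affine hull {x, y} \<inter> (closure X - X) = {chord_end X y x, chord_end X x y}"
proof
  show "affine hull {x, y} \<inter> (closure X - X) \<subseteq> {chord_end X y x, chord_end X x y}"
  proof
    fix p assume p: "p \<in> affine hull {x, y} \<inter> (closure X - X)"
    then obtain u where u: "p = x + u *\<^sub>R (y - x)" by (auto simp: affine_hull_2_alt)
    consider "u < 0" | "0 \<le> u" "u \<le> 1" | "u > 1" by linarith
    then show "p \<in> {chord_end X y x, chord_end X x y}"
    proof cases
      case 1
      have "x \<in> open_segment y p"
        unfolding beyond_iff[OF assms(6)[symmetric]]
        using 1 u by (intro exI[of _ "- u"]) (simp add: algebra_simps)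
      then show ?thesis
        using chord_end_unique[of X y x] chord_end[of X y x] p assms by blast
    next
      case 2
      then have "p \<in> closed_segment x y"
        unfolding in_segment using u by (intro exI[of _ u]) (simp add: algebra_simps)
      then show ?thesis
        using p closed_segment_subset[OF assms(4,5,2)] by blast
    next
      case 3
      have "y \<in> open_segment x p"
        unfolding beyond_iff[OF assms(6)]
        using 3 u by (intro exI[of _ "u - 1"]) (simp add: algebra_simps)
      then show ?thesis
        using chord_end_unique[of X x y] chord_end[of X x y] p assms by blast
    qed
  qed
next
  have "chord_end X a b \<in> affine hull {a, b}" if ab: "a \<in> X" "b \<in> X" "a \<noteq> b" for a b
  proof -
    obtain t where "chord_end X a b = b + t *\<^sub>R (b - a)"
      using chord_end(2)[OF assms(1-3) ab] ab(3) by (auto simp: beyond_iff)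
    then have "chord_end X a b = a + (1 + t) *\<^sub>R (b - a)"
      by (simp add: scaleR_add_left)
    then show ?thesis
      unfolding affine_hull_2_alt by blast
  qed
  from this[of x y] this[of y x]
  show "{chord_end X y x, chord_end X x y} \<subseteq> affine hull {x, y} \<inter> (closure X - X)"
    using chord_end(1)[of X x y] chord_end(1)[of X y x] assms by (simp add: insert_commute)
qed


section \<open>Coarse embeddings\<close>

text \<open>
  The metric space is given by its carrier \<open>Y\<close> and its distance function \<open>d\<close>. Only the values of
  the control functions on the half line \<open>{0..}\<close> matter.
\<close>

definition coarse_embedding ::
    "'a set \<Rightarrow> ('a \<Rightarrow> 'a \<Rightarrow> real) \<Rightarrow> ('a \<Rightarrow> 'h::{real_inner, complete_space}) \<Rightarrow> bool" where
  "coarse_embedding Y d F \<longleftrightarrow>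
     (\<exists>\<rho>m \<rho>p :: real \<Rightarrow> real.
        \<rho>m \<in> {0..} \<rightarrow> {0..} \<and> \<rho>p \<in> {0..} \<rightarrow> {0..} \<and>
        mono_on {0..} \<rho>m \<and> mono_on {0..} \<rho>p \<and>
        filterlim \<rho>m at_top at_top \<and>
        (\<forall>x\<in>Y. \<forall>y\<in>Y. \<rho>m (d x y) \<le> norm (F x - F y) \<and> norm (F x - F y) \<le> \<rho>p (d x y)))"


section \<open>The Hilbert space of square-summable real sequences\<close>

text \<open>
  HOL cannot quantify existentially over types, so embeddability into some Hilbert space is expressed
  with the target \<open>\<ell>\<^sup>2\<close>. Nothing is lost for separable metric spaces: moving every point by a
  distance less than 1 into a countable dense set turns a coarse embedding into one with countable
  image, whose closed linear span is separable and hence embeds isometrically into \<open>\<ell>\<^sup>2\<close>.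
\<close>

typedef ell2 = "{f :: nat \<Rightarrow> real. summable (\<lambda>i. (f i)\<^sup>2)}"
  by (rule exI[of _ "\<lambda>_. 0"]) simp

lemma summable_ell2: "summable (\<lambda>i. (Rep_ell2 x i)\<^sup>2)"
  using Rep_ell2[of x] by simp

lemma Rep_Abs_ell2: "summable (\<lambda>i. (f i)\<^sup>2) \<Longrightarrow> Rep_ell2 (Abs_ell2 f) = f"
  by (simp add: Abs_ell2_inverse)

lemma ell2_eqI: "(\<And>i. Rep_ell2 x i = Rep_ell2 y i) \<Longrightarrow> x = y"
  using Rep_ell2_inject by blast

lemma summable_mult_ell2:
  fixes f g :: "nat \<Rightarrow> real"
  assumes "summable (\<lambda>i. (f i)\<^sup>2)" "summable (\<lambda>i. (g i)\<^sup>2)"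
  shows "summable (\<lambda>i. f i * g i)"
proof (rule summable_comparison_test'[OF summable_add[OF assms], of 0])
  fix i :: nat
  have "2 * (\<bar>f i\<bar> * \<bar>g i\<bar>) \<le> \<bar>f i\<bar>\<^sup>2 + \<bar>g i\<bar>\<^sup>2"
    using sum_squares_bound[of "\<bar>f i\<bar>" "\<bar>g i\<bar>"] by simp
  moreover have "0 \<le> \<bar>f i\<bar> * \<bar>g i\<bar>" by simp
  ultimately have "\<bar>f i\<bar> * \<bar>g i\<bar> \<le> (f i)\<^sup>2 + (g i)\<^sup>2"
    unfolding power2_abs by linarith
  then show "norm (f i * g i) \<le> (f i)\<^sup>2 + (g i)\<^sup>2"
    by (simp add: abs_mult)
qed

lemma summable_add_ell2:
  fixes f g :: "nat \<Rightarrow> real"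
  assumes "summable (\<lambda>i. (f i)\<^sup>2)" "summable (\<lambda>i. (g i)\<^sup>2)"
  shows "summable (\<lambda>i. (f i + g i)\<^sup>2)"
proof -
  have "summable (\<lambda>i. (f i)\<^sup>2 + (g i)\<^sup>2 + 2 * (f i * g i))"
    by (intro summable_add summable_mult assms summable_mult_ell2)
  then show ?thesis by (simp add: power2_sum mult.assoc)
qed

lemma summable_scale_ell2:
  fixes f :: "nat \<Rightarrow> real"
  assumes "summable (\<lambda>i. (f i)\<^sup>2)"
  shows "summable (\<lambda>i. (c * f i)\<^sup>2)"
  using summable_mult[OF assms, of "c\<^sup>2"] by (simp add: power_mult_distrib)

lemma summable_diff_ell2:
  fixes f g :: "nat \<Rightarrow> real"
  assumes "summable (\<lambda>i. (f i)\<^sup>2)" "summable (\<lambda>i. (g i)\<^sup>2)"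
  shows "summable (\<lambda>i. (f i - g i)\<^sup>2)"
  using summable_add_ell2[OF assms(1) summable_scale_ell2[OF assms(2), of "-1"]] by simp

instantiation ell2 :: real_inner
begin

definition "0 = Abs_ell2 (\<lambda>_. 0)"
definition "x + y = Abs_ell2 (\<lambda>i. Rep_ell2 x i + Rep_ell2 y i)"
definition "x - y = Abs_ell2 (\<lambda>i. Rep_ell2 x i - Rep_ell2 y i)"
definition "- x = Abs_ell2 (\<lambda>i. - Rep_ell2 x i)"
definition "c *\<^sub>R x = Abs_ell2 (\<lambda>i. c * Rep_ell2 x i)"
definition "x \<bullet> y = (\<Sum>i. Rep_ell2 x i * Rep_ell2 y i)"
definition norm_ell2_def': "norm x = sqrt (x \<bullet> x)" for x :: ell2
definition "dist x y = norm (x - y)" for x y :: ell2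
definition "sgn x = inverse (norm x) *\<^sub>R x" for x :: ell2
definition "uniformity = (INF e\<in>{0 <..}. principal {(x :: ell2, y). dist x y < e})"
definition "open S = (\<forall>x\<in>S. \<forall>\<^sub>F (x', y) in uniformity. x' = x \<longrightarrow> y \<in> S)" for S :: "ell2 set"

lemma Rep_ell2_zero: "Rep_ell2 0 = (\<lambda>_. 0)"
  unfolding zero_ell2_def by (simp add: Rep_Abs_ell2)

lemma Rep_ell2_add: "Rep_ell2 (x + y) = (\<lambda>i. Rep_ell2 x i + Rep_ell2 y i)"
  unfolding plus_ell2_def by (simp add: Rep_Abs_ell2 summable_add_ell2 summable_ell2)

lemma Rep_ell2_diff: "Rep_ell2 (x - y) = (\<lambda>i. Rep_ell2 x i - Rep_ell2 y i)"
  unfolding minus_ell2_def by (simp add: Rep_Abs_ell2 summable_diff_ell2 summable_ell2)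

lemma Rep_ell2_uminus: "Rep_ell2 (- x) = (\<lambda>i. - Rep_ell2 x i)"
  unfolding uminus_ell2_def by (simp add: Rep_Abs_ell2 summable_ell2)

lemma Rep_ell2_scaleR: "Rep_ell2 (c *\<^sub>R x) = (\<lambda>i. c * Rep_ell2 x i)"
  unfolding scaleR_ell2_def by (simp add: Rep_Abs_ell2 summable_scale_ell2 summable_ell2)

lemmas Rep_ell2_simps =
  Rep_ell2_zero Rep_ell2_add Rep_ell2_diff Rep_ell2_uminus Rep_ell2_scaleR

lemma summable_inner_ell2: "summable (\<lambda>i. Rep_ell2 x i * Rep_ell2 y i)"
  by (intro summable_mult_ell2 summable_ell2)

instance
proof
  fix x y z :: ell2 and a b :: real
  show "x + y + z = x + (y + z)" "x + y = y + x" "0 + x = x" "- x + x = 0" "x - y = x + - y"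
    "a *\<^sub>R (x + y) = a *\<^sub>R x + a *\<^sub>R y" "(a + b) *\<^sub>R x = a *\<^sub>R x + b *\<^sub>R x"
    "a *\<^sub>R b *\<^sub>R x = (a * b) *\<^sub>R x" "1 *\<^sub>R x = x"
    by (rule ell2_eqI; simp add: Rep_ell2_simps algebra_simps)+
  show "x \<bullet> y = y \<bullet> x"
    by (simp add: inner_ell2_def mult.commute)
  show "(x + y) \<bullet> z = x \<bullet> z + y \<bullet> z"
    unfolding inner_ell2_def Rep_ell2_simps
    by (simp add: distrib_right suminf_add summable_inner_ell2)
  show "(a *\<^sub>R x) \<bullet> y = a * (x \<bullet> y)"
    unfolding inner_ell2_def Rep_ell2_simps
    by (simp add: mult.assoc suminf_mult summable_inner_ell2)
  show "0 \<le> x \<bullet> x"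
    unfolding inner_ell2_def by (intro suminf_nonneg summable_inner_ell2) simp
  show "x \<bullet> x = 0 \<longleftrightarrow> x = 0"
  proof
    assume "x \<bullet> x = 0"
    then have "\<forall>i. Rep_ell2 x i * Rep_ell2 x i = 0"
      unfolding inner_ell2_def using suminf_eq_zero_iff[OF summable_inner_ell2[of x x]] by simp
    then show "x = 0" by (intro ell2_eqI) (simp add: Rep_ell2_simps)
  qed (simp add: inner_ell2_def Rep_ell2_simps)
qed (rule norm_ell2_def' dist_ell2_def sgn_ell2_def uniformity_ell2_def open_ell2_def)+

end

lemma norm_ell2: "norm x = sqrt (\<Sum>i. (Rep_ell2 x i)\<^sup>2)"
  by (simp add: norm_ell2_def' inner_ell2_def power2_eq_square)

lemma sum_le_norm_ell2: "(\<Sum>i<n. (Rep_ell2 x i)\<^sup>2) \<le> (norm x)\<^sup>2"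
proof -
  have "(norm x)\<^sup>2 = (\<Sum>i. (Rep_ell2 x i)\<^sup>2)"
    unfolding norm_ell2 by (simp add: suminf_nonneg summable_ell2)
  then show ?thesis
    using sum_le_suminf[OF summable_ell2, of "{..<n}" x] by simp
qed

lemma abs_Rep_ell2_le_norm: "\<bar>Rep_ell2 x i\<bar> \<le> norm x"
proof -
  have "(Rep_ell2 x i)\<^sup>2 \<le> (\<Sum>j<Suc i. (Rep_ell2 x j)\<^sup>2)"
    by (rule member_le_sum) auto
  also have "\<dots> \<le> (norm x)\<^sup>2" by (rule sum_le_norm_ell2)
  finally show ?thesis by (simp add: abs_le_square_iff[symmetric])
qed

instance ell2 :: complete_space
proof
  fix F :: "nat \<Rightarrow> ell2"
  assume F: "Cauchy F"
  have "Cauchy (\<lambda>k. Rep_ell2 (F k) i)" for i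
  proof (rule metric_CauchyI)
    fix e :: real assume "0 < e"
    then obtain M where M: "\<And>m n. m \<ge> M \<Longrightarrow> n \<ge> M \<Longrightarrow> dist (F m) (F n) < e"
      using metric_CauchyD[OF F] by blast
    have "dist (Rep_ell2 (F m) i) (Rep_ell2 (F n) i) < e" if "m \<ge> M" "n \<ge> M" for m n
      using abs_Rep_ell2_le_norm[of "F m - F n" i] M[OF that]
      by (simp add: Rep_ell2_diff dist_norm)
    then show "\<exists>M. \<forall>m\<ge>M. \<forall>n\<ge>M. dist (Rep_ell2 (F m) i) (Rep_ell2 (F n) i) < e" by blast
  qed
  then have conv: "convergent (\<lambda>k. Rep_ell2 (F k) i)" for i
    by (rule Cauchy_convergent)
  define l where "l i = lim (\<lambda>k. Rep_ell2 (F k) i)" for i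
  have l: "(\<lambda>k. Rep_ell2 (F k) i) \<longlonglongrightarrow> l i" for i
    unfolding l_def by (rule iffD1[OF convergent_LIMSEQ_iff conv])
  have bound: "\<exists>M. \<forall>m\<ge>M. \<forall>n. (\<Sum>i<n. (Rep_ell2 (F m) i - l i)\<^sup>2) \<le> e\<^sup>2" if "e > 0" for e
  proof -
    obtain M where M: "\<And>m n. m \<ge> M \<Longrightarrow> n \<ge> M \<Longrightarrow> dist (F m) (F n) < e"
      using metric_CauchyD[OF F \<open>e > 0\<close>] by blast
    have "(\<Sum>i<n. (Rep_ell2 (F m) i - l i)\<^sup>2) \<le> e\<^sup>2" if "m \<ge> M" for m n
    proof (rule LIMSEQ_le_const2)
      show "(\<lambda>k. \<Sum>i<n. (Rep_ell2 (F m) i - Rep_ell2 (F k) i)\<^sup>2)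
              \<longlonglongrightarrow> (\<Sum>i<n. (Rep_ell2 (F m) i - l i)\<^sup>2)"
        by (intro tendsto_intros l)
      have "(\<Sum>i<n. (Rep_ell2 (F m) i - Rep_ell2 (F k) i)\<^sup>2) \<le> e\<^sup>2" if "k \<ge> M" for k
      proof -
        have "(\<Sum>i<n. (Rep_ell2 (F m) i - Rep_ell2 (F k) i)\<^sup>2) \<le> (norm (F m - F k))\<^sup>2"
          using sum_le_norm_ell2[of "F m - F k" n] by (simp add: Rep_ell2_diff)
        also have "\<dots> \<le> e\<^sup>2"
          using M[OF \<open>m \<ge> M\<close> \<open>k \<ge> M\<close>] by (intro power_mono) (auto simp: dist_norm)
        finally show ?thesis .
      qed
      then show "\<exists>K. \<forall>k\<ge>K. (\<Sum>i<n. (Rep_ell2 (F m) i - Rep_ell2 (F k) i)\<^sup>2) \<le> e\<^sup>2"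
        by blast
    qed
    then show ?thesis by blast
  qed
  have summ: "summable (\<lambda>i. (Rep_ell2 (F m) i - l i)\<^sup>2)"
    if "\<forall>n. (\<Sum>i<n. (Rep_ell2 (F m) i - l i)\<^sup>2) \<le> c" for m c
    using that by (intro summableI_nonneg_bounded[of _ c]) auto
  obtain M1 where "\<forall>n. (\<Sum>i<n. (Rep_ell2 (F M1) i - l i)\<^sup>2) \<le> 1\<^sup>2"
    using bound[of 1] by auto
  then have "summable (\<lambda>i. (Rep_ell2 (F M1) i - (Rep_ell2 (F M1) i - l i))\<^sup>2)"
    by (rule summable_diff_ell2[OF summable_ell2 summ])
  then have L: "Rep_ell2 (Abs_ell2 l) = l"
    by (intro Rep_Abs_ell2) simp
  have "F \<longlonglongrightarrow> Abs_ell2 l"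
  proof (rule metric_LIMSEQ_I)
    fix r :: real assume "0 < r"
    then obtain M where M: "\<forall>m\<ge>M. \<forall>n. (\<Sum>i<n. (Rep_ell2 (F m) i - l i)\<^sup>2) \<le> (r / 2)\<^sup>2"
      using bound[of "r / 2"] by auto
    have "dist (F m) (Abs_ell2 l) < r" if "m \<ge> M" for m
    proof -
      have m: "\<forall>n. (\<Sum>i<n. (Rep_ell2 (F m) i - l i)\<^sup>2) \<le> (r / 2)\<^sup>2"
        using M that by blast
      have "(\<Sum>i. (Rep_ell2 (F m) i - l i)\<^sup>2) \<le> (r / 2)\<^sup>2"
        using m summ by (intro suminf_le_const) blast+
      then have "norm (F m - Abs_ell2 l) \<le> r / 2"
        unfolding norm_ell2 Rep_ell2_diff L using \<open>0 < r\<close> by (intro real_le_lsqrt) auto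
      then show ?thesis using \<open>0 < r\<close> by (simp add: dist_norm)
    qed
    then show "\<exists>no. \<forall>n\<ge>no. dist (F n) (Abs_ell2 l) < r" by blast
  qed
  then show "convergent F" by (auto simp: convergent_def)
qed

end

theory Submission
  imports Defs
begin

text \<open>
  The square root of the Hilbert metric \<open>d\<close> of a planar domain embeds isometrically into a Hilbert
  space, on every countable subset, because \<open>d\<close> is a limit of sums of pseudometrics
  \<open>\<bar>\<psi> x - \<psi> y\<bar>\<close>.

  Let \<open>gap X v x\<close> be the difference of the support function of \<open>X\<close> at \<open>v\<close> and \<open>x \<bullet> v\<close>; for a unit
  vector \<open>v\<close> this is the distance from \<open>x\<close> to the supporting line of \<open>X\<close> with outer normal \<open>v\<close>. A
  ratio \<open>gap X v x / gap X v y\<close> is largest when that line touches \<open>X\<close> at the end of the chord beyond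
  \<open>y\<close>, and its largest value is the corresponding ratio of distances on the chord. Hence
  \<open>d x y\<close> is the oscillation (maximum minus minimum) over all directions \<open>v\<close> of
  \<open>u v = ln (gap X v x / gap X v y)\<close>; see \<open>log_gap_diff_le_Hilbert_metric\<close> and
  \<open>Hilbert_metric_attained\<close>.

  In the plane the directions form a circle, and \<open>u\<close> goes up once and down once around it: the
  sign of \<open>u v - c\<close> is that of a function of \<open>v\<close> which is sublinear up to a sign, so it cannot
  alternate twice (\<open>log_gap_no_alternation\<close>). The oscillation of such a function is half of its total
  variation (\<open>cyclic_variation\<close>). Computed on a finite grid of directions, the total variation is
  a sum of terms \<open>\<bar>\<psi> x - \<psi> y\<bar>\<close>, where \<open>\<psi>\<close> is the difference of \<open>ln \<circ> gap X v\<close> at neighbouring grid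
  directions \<open>v\<close>, and as the grid gets finer it converges to \<open>2 * d x y\<close>
  (\<open>grid_variation_tendsto\<close>).

  A kernel \<open>\<bar>\<psi> x - \<psi> y\<bar>\<close> on the line is conditionally negative definite, and this passes to sums and
  limits. So \<open>d x z + d y z - d x y\<close> is a positive semidefinite kernel in \<open>x\<close> and \<open>y\<close>
  (\<open>psd_Hilbert_metric\<close>). A Cholesky decomposition realises it on a sequence of points by vectors of
  \<open>\<ell>\<^sup>2\<close> (\<open>psd_gram\<close>). Finally, every point of \<open>X\<close> is within Hilbert distance 2 of a suitable
  sequence of points, and moving points by a bounded amount does not affect coarse embeddings.
\<close>

section \<open>Positive semidefinite kernels\<close>

definition psd :: "('i \<Rightarrow> 'i \<Rightarrow> real) \<Rightarrow> bool" where
  "psd K \<longleftrightarrow> (\<forall>i j. K i j = K j i) \<and>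
     (\<forall>A c. finite A \<longrightarrow> 0 \<le> (\<Sum>i\<in>A. \<Sum>j\<in>A. c i * c j * K i j))"

lemma psdI:
  assumes "\<And>i j. K i j = K j i"
    and "\<And>A c. finite A \<Longrightarrow> 0 \<le> (\<Sum>i\<in>A. \<Sum>j\<in>A. c i * c j * K i j)"
  shows "psd K"
  using assms unfolding psd_def by blast

lemma psd_sym: "psd K \<Longrightarrow> K i j = K j i"
  unfolding psd_def by blast

lemma psd_nonneg: "psd K \<Longrightarrow> finite A \<Longrightarrow> 0 \<le> (\<Sum>i\<in>A. \<Sum>j\<in>A. c i * c j * K i j)"
  unfolding psd_def by blast

lemma psd_add:
  assumes "psd K" "psd L"
  shows "psd (\<lambda>i j. K i j + L i j)"
proof (rule psdI)
  show "K i j + L i j = K j i + L j i" for i j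
    using assms by (simp add: psd_sym)
  show "0 \<le> (\<Sum>i\<in>A. \<Sum>j\<in>A. c i * c j * (K i j + L i j))" if "finite A" for A c
    using psd_nonneg[OF assms(1) that, of c] psd_nonneg[OF assms(2) that, of c]
    by (simp add: distrib_left sum.distrib)
qed

lemma psd_scale:
  assumes "psd K" "0 \<le> r"
  shows "psd (\<lambda>i j. r * K i j)"
proof (rule psdI)
  show "r * K i j = r * K j i" for i j
    using assms(1) by (simp add: psd_sym)
  show "0 \<le> (\<Sum>i\<in>A. \<Sum>j\<in>A. c i * c j * (r * K i j))" if "finite A" for A c
  proof -
    have "(\<Sum>i\<in>A. \<Sum>j\<in>A. c i * c j * (r * K i j)) = r * (\<Sum>i\<in>A. \<Sum>j\<in>A. c i * c j * K i j)"
      by (simp add: sum_distrib_left algebra_simps)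
    then show ?thesis
      using psd_nonneg[OF assms(1) that, of c] assms(2) by simp
  qed
qed

lemma psd_sum:
  assumes "\<And>m. m \<in> M \<Longrightarrow> psd (K m)"
  shows "psd (\<lambda>i j. \<Sum>m\<in>M. K m i j)"
  using assms
proof (induction M rule: infinite_finite_induct)
  case (insert m M)
  then show ?case
    using psd_add[of "K m" "\<lambda>i j. \<Sum>m\<in>M. K m i j"] by simp
qed (simp_all add: psd_def)

lemma psd_limit:
  assumes "\<And>n. psd (K n)" and lim: "\<And>i j. (\<lambda>n. K n i j) \<longlonglongrightarrow> L i j"
  shows "psd L"
proof (rule psdI)
  show "L i j = L j i" for i j
  proof (rule LIMSEQ_unique[OF lim])
    show "(\<lambda>n. K n i j) \<longlonglongrightarrow> L j i"
      using lim[of j i] psd_sym[OF assms(1), of _ i j] by simp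
  qed
  show "0 \<le> (\<Sum>i\<in>A. \<Sum>j\<in>A. c i * c j * L i j)" if "finite A" for A c
  proof (rule LIMSEQ_le_const)
    show "(\<lambda>n. \<Sum>i\<in>A. \<Sum>j\<in>A. c i * c j * K n i j) \<longlonglongrightarrow> (\<Sum>i\<in>A. \<Sum>j\<in>A. c i * c j * L i j)"
      by (intro tendsto_intros lim)
  qed (use psd_nonneg[OF assms(1) that] in blast)
qed

text \<open>
  By induction on \<open>A\<close>: subtracting the smallest value \<open>a k\<close> from all \<open>a i\<close> splits off the square
  \<open>a k * (\<Sum>i\<in>A. c i)\<^sup>2\<close> and leaves the same form without the index \<open>k\<close>.
\<close>

lemma min_quadratic_form_nonneg:
  fixes a c :: "'i \<Rightarrow> real"
  assumes "finite A" "\<And>i. i \<in> A \<Longrightarrow> 0 \<le> a i"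
  shows "0 \<le> (\<Sum>i\<in>A. \<Sum>j\<in>A. c i * c j * min (a i) (a j))"
  using assms
proof (induction A arbitrary: a rule: finite_psubset_induct)
  case (psubset A)
  show ?case
  proof (cases "A = {}")
    case False
    have "Min (a ` A) \<in> a ` A"
      using psubset.hyps False by (intro Min_in) auto
    then obtain k where k: "k \<in> A" "a k = Min (a ` A)" by auto
    then have le: "a k \<le> a i" if "i \<in> A" for i
      using psubset.hyps that by simp
    define b where "b i = a i - a k" for i
    have "(\<Sum>i\<in>A. \<Sum>j\<in>A. c i * c j * min (a i) (a j))
        = (\<Sum>i\<in>A. \<Sum>j\<in>A. a k * (c i * c j) + c i * c j * min (b i) (b j))"
      by (intro sum.cong refl) (auto simp: b_def min_def algebra_simps)
    also have "\<dots> = a k * (\<Sum>i\<in>A. c i)\<^sup>2 + (\<Sum>i\<in>A. \<Sum>j\<in>A. c i * c j * min (b i) (b j))"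
      unfolding power2_eq_square sum_product by (simp add: sum.distrib sum_distrib_left)
    also have "(\<Sum>i\<in>A. \<Sum>j\<in>A. c i * c j * min (b i) (b j))
        = (\<Sum>i\<in>A - {k}. \<Sum>j\<in>A - {k}. c i * c j * min (b i) (b j))"
    proof (rule sum.mono_neutral_cong_right)
      show "\<forall>i\<in>A - (A - {k}). (\<Sum>j\<in>A. c i * c j * min (b i) (b j)) = 0"
        using le by (auto intro!: sum.neutral simp: b_def min_def)
      show "(\<Sum>j\<in>A. c i * c j * min (b i) (b j)) = (\<Sum>j\<in>A - {k}. c i * c j * min (b i) (b j))"
        if "i \<in> A - {k}" for i
        using le that psubset.hyps
        by (intro sum.mono_neutral_right) (auto simp: b_def min_def dest: order.antisym)
    qed (use psubset.hyps in auto)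
    moreover have "0 \<le> (\<Sum>i\<in>A - {k}. \<Sum>j\<in>A - {k}. c i * c j * min (b i) (b j))"
      using k(1) le by (intro psubset.IH) (auto simp: b_def)
    ultimately show ?thesis
      using psubset.prems k(1) by simp
  qed simp
qed

lemma psd_min:
  fixes a :: "'i \<Rightarrow> real"
  assumes "\<And>i. 0 \<le> a i"
  shows "psd (\<lambda>i j. min (a i) (a j))"
  by (intro psdI min_quadratic_form_nonneg assms) (simp_all add: min.commute)

text \<open>
  Up to the factor 2 this is the kernel \<open>min\<close> applied to the positive parts of \<open>a i - b\<close> and
  \<open>a j - b\<close>, plus the same for the negative parts.
\<close>

lemma psd_abs_diff:
  fixes a :: "'i \<Rightarrow> real"
  shows "psd (\<lambda>i j. \<bar>a i - b\<bar> + \<bar>a j - b\<bar> - \<bar>a i - a j\<bar>)"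
proof -
  let ?p = "\<lambda>i. max (a i - b) 0" and ?n = "\<lambda>i. max (b - a i) 0"
  have "psd (\<lambda>i j. 2 * (min (?p i) (?p j) + min (?n i) (?n j)))"
    by (intro psd_scale psd_add psd_min) auto
  moreover have "2 * (min (?p i) (?p j) + min (?n i) (?n j))
      = \<bar>a i - b\<bar> + \<bar>a j - b\<bar> - \<bar>a i - a j\<bar>" for i j
    by (simp add: min_def max_def abs_if)
  ultimately show ?thesis by simp
qed

section \<open>Cholesky decomposition in \<open>\<ell>\<^sup>2\<close>\<close>

text \<open>
  Otherwise the form restricted to \<open>{i, m}\<close> would be affine and not constant in the weight of
  \<open>m\<close>, hence negative somewhere.
\<close>

lemma psd_zero_diagonal:
  assumes "psd K" "K m m = 0"
  shows "K i m = 0"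
proof (rule ccontr)
  assume nz: "K i m \<noteq> 0"
  with assms(2) have "i \<noteq> m" by auto
  \<comment> \<open>At this weight the form takes the value -1.\<close>
  define t where "t = - (K i i + 1) / (2 * K i m)"
  have "0 \<le> (\<Sum>p\<in>{i, m}. \<Sum>q\<in>{i, m}. (if p = i then 1 else t) * (if q = i then 1 else t) * K p q)"
    by (intro psd_nonneg[OF assms(1), of _ "\<lambda>p. if p = i then 1 else t"]) simp
  also have "\<dots> = K i i + 2 * t * K i m"
    using \<open>i \<noteq> m\<close> assms psd_sym[OF assms(1), of m i] by simp
  also have "\<dots> = -1"
    using nz by (simp add: t_def field_simps)
  finally show False by simp
qed

text \<open>
  One step of the Cholesky decomposition. At a zero pivot \<open>K m m\<close> division by zero makes the
  subtracted term vanish, so that the step leaves \<open>K\<close> as it is.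
\<close>

definition schur_step :: "('i \<Rightarrow> 'i \<Rightarrow> real) \<Rightarrow> 'i \<Rightarrow> 'i \<Rightarrow> 'i \<Rightarrow> real" where
  "schur_step K m i j = K i j - K i m * K j m / K m m"

text \<open>
  For a nonzero pivot \<open>K m m\<close>, the new form at \<open>c\<close> is the old form at
  \<open>c - l e\<^sub>m\<close>, where \<open>l\<close> minimises the latter.
\<close>

lemma psd_schur_step:
  assumes K: "psd K"
  shows "psd (schur_step K m)"
proof (cases "K m m = 0")
  case True
  then have "schur_step K m = K"
    by (simp add: schur_step_def fun_eq_iff)
  then show ?thesis using K by simp
next
  case False
  show ?thesis
  proof (rule psdI)
    show "schur_step K m i j = schur_step K m j i" for i j
      using psd_sym[OF K] by (simp add: schur_step_def)
    fix A :: "'a set" and c :: "'a \<Rightarrow> real"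
    assume A: "finite A"
    define B where "B = insert m A"
    define c' where "c' i = (if i \<in> A then c i else 0)" for i
    define S where "S = (\<Sum>i\<in>B. c' i * K i m)"
    define l where "l = S / K m m"
    define w where "w i = c' i - (if i = m then l else 0)" for i
    have B: "finite B" "m \<in> B" using A by (auto simp: B_def)
    have inner: "(\<Sum>j\<in>B. w j * K i j) = (\<Sum>j\<in>B. c' j * K i j) - l * K i m" for i
    proof -
      have "(\<Sum>j\<in>B. w j * K i j) = (\<Sum>j\<in>B. c' j * K i j - (if j = m then l * K i m else 0))"
        by (intro sum.cong refl) (simp add: w_def left_diff_distrib)
      then show ?thesis using B by (simp add: sum_subtractf)
    qed
    have "(\<Sum>i\<in>B. \<Sum>j\<in>B. w i * w j * K i j) = (\<Sum>i\<in>B. w i * (\<Sum>j\<in>B. w j * K i j))"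
      by (simp add: sum_distrib_left mult.assoc)
    also have "\<dots> = (\<Sum>i\<in>B. c' i * ((\<Sum>j\<in>B. c' j * K i j) - l * K i m)
        - (if i = m then l * ((\<Sum>j\<in>B. c' j * K m j) - l * K m m) else 0))"
      unfolding inner by (intro sum.cong refl) (simp add: w_def left_diff_distrib)
    also have "\<dots> = (\<Sum>i\<in>B. c' i * ((\<Sum>j\<in>B. c' j * K i j) - l * K i m))
        - l * ((\<Sum>j\<in>B. c' j * K m j) - l * K m m)"
      using B by (simp add: sum_subtractf)
    also have "(\<Sum>j\<in>B. c' j * K m j) = S"
      unfolding S_def by (simp add: psd_sym[OF K, of m])
    also have "S - l * K m m = 0"
      using False by (simp add: l_def)
    also have "(\<Sum>i\<in>B. c' i * ((\<Sum>j\<in>B. c' j * K i j) - l * K i m))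
        = (\<Sum>i\<in>B. \<Sum>j\<in>B. c' i * c' j * K i j) - l * S"
      by (simp add: S_def right_diff_distrib sum_subtractf sum_distrib_left algebra_simps)
    also have "l * S = (\<Sum>i\<in>B. \<Sum>j\<in>B. c' i * c' j * (K i m * K j m / K m m))"
      by (simp add: l_def S_def sum_product sum_divide_distrib algebra_simps)
    finally have "(\<Sum>i\<in>B. \<Sum>j\<in>B. w i * w j * K i j)
        = (\<Sum>i\<in>B. \<Sum>j\<in>B. c' i * c' j * (K i j - K i m * K j m / K m m))"
      by (simp add: right_diff_distrib sum_subtractf)
    also have "\<dots> = (\<Sum>i\<in>A. \<Sum>j\<in>A. c i * c j * (K i j - K i m * K j m / K m m))"
      using A by (intro sum.mono_neutral_cong_right ballI sum.neutral)
        (auto simp: B_def c'_def intro!: sum.mono_neutral_cong_right)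
    finally show "0 \<le> (\<Sum>i\<in>A. \<Sum>j\<in>A. c i * c j * schur_step K m i j)"
      using psd_nonneg[OF K B(1), of w] by (simp add: schur_step_def)
  qed
qed

text \<open>
  The remainders of the Cholesky decomposition of \<open>K\<close>: the \<open>n\<close>-th one is the Schur complement of
  \<open>K\<close> with respect to the indices below \<open>n\<close>, zero pivots being skipped.
\<close>

primrec schur :: "(nat \<Rightarrow> nat \<Rightarrow> real) \<Rightarrow> nat \<Rightarrow> nat \<Rightarrow> nat \<Rightarrow> real" where
  "schur K 0 = K"
| "schur K (Suc n) = schur_step (schur K n) n"

lemma psd_schur: "psd K \<Longrightarrow> psd (schur K n)"
  by (induction n) (simp_all add: psd_schur_step)

text \<open>
  Step \<open>n\<close> clears row \<open>n\<close>. When the pivot is zero the step does nothing, but then the row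
  is already zero by \<open>psd_zero_diagonal\<close>.
\<close>

lemma schur_eq_0:
  assumes "psd K" "i < n"
  shows "schur K n i j = 0"
  using assms(2)
proof (induction n arbitrary: i j)
  case (Suc n)
  note P = psd_schur[OF assms(1), of n]
  show ?case
  proof (cases "i = n")
    case True
    then show ?thesis
      using psd_zero_diagonal[OF P, of n j] psd_sym[OF P, of n j]
      by (cases "schur K n n n = 0") (simp_all add: schur_step_def)
  next
    case False
    then show ?thesis using Suc by (simp add: schur_step_def)
  qed
qed simp

text \<open>
  The columns removed by the successive Schur steps are the coordinates. The vector of index \<open>i\<close>
  has no coordinates beyond \<open>i\<close>, so all sums are finite.
\<close>

lemma psd_gram:
  fixes K :: "nat \<Rightarrow> nat \<Rightarrow> real"
  assumes K: "psd K"
  shows "\<exists>G :: nat \<Rightarrow> ell2. \<forall>i j. (norm (G i - G j))\<^sup>2 = K i i + K j j - 2 * K i j"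
proof (intro exI allI)
  define v where "v i n = schur K n i n / sqrt (schur K n n n)" for i n
  note P = psd_schur[OF K]
  have diag: "0 \<le> schur K n n n" for n
    using psd_nonneg[OF P, of "{n}" "\<lambda>_. 1" n] by simp
  have zero: "v i n = 0" if "i < n" for i n
    using that by (simp add: v_def schur_eq_0[OF K])
  have expand: "K i j = (\<Sum>n<N. v i n * v j n) + schur K N i j" for i j N
  proof (induction N)
    case (Suc N)
    have "v i N * v j N = schur K N i N * schur K N j N / schur K N N N"
      using diag[of N] by (simp add: v_def)
    then show ?case using Suc by (simp add: schur_step_def)
  qed simp
  have eq: "K i j = (\<Sum>n<N. v i n * v j n)" if "i < N" for i j N
    using expand[of i j N] schur_eq_0[OF K that, of j] by simp
  have "summable (\<lambda>n. (v i n)\<^sup>2)" for i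
    by (rule summable_finite[of "{..i}"]) (auto simp: zero)
  then have rep: "Rep_ell2 (Abs_ell2 (v i)) = v i" for i
    by (rule Rep_Abs_ell2)
  show "(norm (Abs_ell2 (v i) - Abs_ell2 (v j)))\<^sup>2 = K i i + K j j - 2 * K i j" for i j
  proof -
    define N where "N = Suc (max i j)"
    have N: "i < N" "j < N" by (auto simp: N_def)
    have "(norm (Abs_ell2 (v i) - Abs_ell2 (v j)))\<^sup>2 = (\<Sum>n. (v i n - v j n)\<^sup>2)"
      unfolding norm_ell2 Rep_ell2_diff rep
      by (intro real_sqrt_pow2 suminf_nonneg summable_finite[of "{..<N}"]) (use N in \<open>auto simp: zero\<close>)
    also have "\<dots> = (\<Sum>n<N. (v i n - v j n)\<^sup>2)"
      by (rule suminf_finite) (use N in \<open>auto simp: zero\<close>)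
    also have "\<dots> = (\<Sum>n<N. v i n * v i n + v j n * v j n - 2 * (v i n * v j n))"
      by (intro sum.cong refl) (simp add: power2_eq_square algebra_simps)
    also have "\<dots> = K i i + K j j - 2 * K i j"
      by (simp add: sum.distrib sum_subtractf sum_distrib_left[symmetric] eq[OF N(1)] eq[OF N(2)])
    finally show ?thesis .
  qed
qed

section \<open>Variation of periodic sequences\<close>

lemma sum_periodic_shift:
  fixes g :: "nat \<Rightarrow> 'b::ab_group_add"
  assumes "\<And>i. g (i + N) = g i"
  shows "(\<Sum>i\<in>{p..<p + N}. g i) = (\<Sum>i<N. g i)"
proof (induction p)
  case 0
  then show ?case by (simp add: lessThan_atLeast0)
next
  case (Suc p)
  have "g p + (\<Sum>i\<in>{Suc p..<Suc p + N}. g i) = (\<Sum>i\<in>{p..<Suc (p + N)}. g i)"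
    by (simp add: sum.atLeast_Suc_lessThan)
  also have "\<dots> = (\<Sum>i\<in>{p..<p + N}. g i) + g p"
    by (simp add: assms)
  finally show ?case using Suc by (simp add: add.commute)
qed

lemma sum_abs_diff_decreasing:
  fixes u :: "nat \<Rightarrow> real"
  assumes "p \<le> q" "\<And>i j. p \<le> i \<Longrightarrow> i < j \<Longrightarrow> j \<le> q \<Longrightarrow> u j \<le> u i"
  shows "(\<Sum>i\<in>{p..<q}. \<bar>u (Suc i) - u i\<bar>) = u p - u q"
proof -
  have "(\<Sum>i\<in>{p..<q}. \<bar>u (Suc i) - u i\<bar>) = (\<Sum>i\<in>{p..<q}. - (u (Suc i) - u i))"
  proof (rule sum.cong)
    show "\<bar>u (Suc i) - u i\<bar> = - (u (Suc i) - u i)" if "i \<in> {p..<q}" for i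
      using assms(2)[of i "Suc i"] that by simp
  qed simp
  also have "\<dots> = u p - u q"
    using assms(1) by (simp add: sum_negf sum_Suc_diff' del: minus_diff_eq)
  finally show ?thesis .
qed

text \<open>
  The hypothesis \<open>alt\<close> excludes values that are in turn above, below, above and below some level \<open>c\<close>
  within one period. Hence the sequence decreases from a maximum \<open>p\<close> to the next
  minimum \<open>q\<close>, and then increases up to \<open>p + N\<close>: a violation of either monotonicity gives, together with \<open>p\<close> and \<open>q\<close>, such a
  pattern.
\<close>

lemma cyclic_variation:
  fixes u :: "nat \<Rightarrow> real"
  assumes N: "0 < N" and per: "\<And>i. u (i + N) = u i"
    and alt: "\<And>i j k l c. \<lbrakk>i < j; j < k; k < l; l < i + N; u i > c; u j < c; u k > c\<rbrakk> \<Longrightarrow> u l \<ge> c"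
  obtains p q where "\<And>i. u i \<le> u p" "\<And>i. u q \<le> u i"
    "(\<Sum>i<N. \<bar>u (Suc i) - u i\<bar>) = 2 * (u p - u q)"
proof -
  have mod: "u (i mod N) = u i" for i
  proof -
    have "u (j + k * N) = u j" for j k
    proof (induction k)
      case (Suc k)
      then show ?case using per[of "j + k * N"] by (simp add: ac_simps)
    qed simp
    from this[of "i mod N" "i div N"] show ?thesis by (simp add: mod_div_mult_eq)
  qed
  have fin: "finite (u ` {..<N})" "u ` {..<N} \<noteq> {}" using N by auto
  obtain p where p: "p < N" "u p = Max (u ` {..<N})" using Max_in[OF fin] by auto
  obtain q0 where q0: "q0 < N" "u q0 = Min (u ` {..<N})" using Min_in[OF fin] by auto
  have in_img: "u i \<in> u ` {..<N}" for i
    using N mod[of i] by (auto intro!: image_eqI[of _ _ "i mod N"])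
  have max: "u i \<le> u p" for i
    using Max_ge[OF fin(1) in_img] p(2) by simp
  have min0: "u q0 \<le> u i" for i
    using Min_le[OF fin(1) in_img] q0(2) by simp
  obtain q where q: "p \<le> q" "q < p + N" "u q = u q0"
  proof (cases "p \<le> q0")
    case True
    then show ?thesis using that[of q0] q0(1) by simp
  next
    case False
    then show ?thesis using that[of "q0 + N"] p(1) per[of q0] by simp
  qed
  have min: "u q \<le> u i" for i
    using min0 q(3) by simp
  have "u j \<le> u i" if ij: "p \<le> i" "i < j" "j \<le> q" for i j
  proof (rule ccontr)
    assume "\<not> u j \<le> u i"
    then have less: "u i < u j" by simp
    then have "i \<noteq> p" "j \<noteq> q" using max[of j] min[of i] by auto
    then have "p < i" "j < q" using ij by simp_all
    moreover have "u p > (u i + u j) / 2" "u i < (u i + u j) / 2" "u j > (u i + u j) / 2"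
      using less max[of j] by auto
    ultimately have "u q \<ge> (u i + u j) / 2"
      using alt ij(2) q(2) by blast
    then show False using less min[of i] by (simp add: field_simps)
  qed
  then have down: "(\<Sum>i\<in>{p..<q}. \<bar>u (Suc i) - u i\<bar>) = u p - u q"
    by (rule sum_abs_diff_decreasing[OF q(1)])
  have "- u j \<le> - u i" if ij: "q \<le> i" "i < j" "j \<le> p + N" for i j
  proof (rule ccontr)
    assume "\<not> - u j \<le> - u i"
    then have less: "u j < u i" by simp
    then have ne: "j \<noteq> p + N" "i \<noteq> q" using max[of i] min[of j] per[of p] by auto
    have "u q < u p" using max[of i] min[of j] less by simp
    then have "p \<noteq> q" by auto
    then have "p < q" "q < i" "j < p + N" using ij ne q(1) by simp_all
    moreover have "u p > (u i + u j) / 2" "u q < (u i + u j) / 2" "u i > (u i + u j) / 2"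
      using less max[of i] min[of j] by auto
    ultimately have "u j \<ge> (u i + u j) / 2"
      using alt ij(2) by blast
    then show False using less by (simp add: field_simps)
  qed
  then have "(\<Sum>i\<in>{q..<p + N}. \<bar>- u (Suc i) - - u i\<bar>) = - u q - - u (p + N)"
    using q(2) by (intro sum_abs_diff_decreasing[where u = "\<lambda>i. - u i"]) simp_all
  then have up: "(\<Sum>i\<in>{q..<p + N}. \<bar>u (Suc i) - u i\<bar>) = u p - u q"
    by (simp add: per abs_minus_commute)
  have "(\<Sum>i<N. \<bar>u (Suc i) - u i\<bar>) = (\<Sum>i\<in>{p..<p + N}. \<bar>u (Suc i) - u i\<bar>)"
    using per by (intro sum_periodic_shift[symmetric]) (simp flip: add_Suc)
  also have "\<dots> = 2 * (u p - u q)"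
    using sum.atLeastLessThan_concat[of p q "p + N" "\<lambda>i. \<bar>u (Suc i) - u i\<bar>"] down up q by simp
  finally show ?thesis using that max min by blast
qed

section \<open>The Hilbert metric and the support function\<close>

definition support :: "'a::euclidean_space set \<Rightarrow> 'a \<Rightarrow> real" where
  "support X v = (SUP x\<in>X. x \<bullet> v)"

definition gap :: "'a::euclidean_space set \<Rightarrow> 'a \<Rightarrow> 'a \<Rightarrow> real" where
  "gap X v x = support X v - x \<bullet> v"

definition log_gap :: "'a::euclidean_space set \<Rightarrow> 'a \<Rightarrow> 'a \<Rightarrow> 'a \<Rightarrow> real" where
  "log_gap X v x y = ln (gap X v x) - ln (gap X v y)"

lemma inner_le_support:
  assumes "bounded X" "x \<in> X"
  shows "x \<bullet> v \<le> support X v"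
  unfolding support_def using assms by (intro cSUP_upper bounded_inner_imp_bdd_above)

lemma support_le:
  assumes "X \<noteq> {}" "\<And>x. x \<in> X \<Longrightarrow> x \<bullet> v \<le> b"
  shows "support X v \<le> b"
  unfolding support_def using assms by (intro cSUP_least)

lemma inner_le_support_closure:
  assumes "bounded X" "x \<in> closure X"
  shows "x \<bullet> v \<le> support X v"
proof -
  have "closure X \<subseteq> {x. v \<bullet> x \<le> support X v}"
    using inner_le_support[OF assms(1), of _ v]
    by (intro closure_minimal closed_halfspace_le) (auto simp: inner_commute)
  then show ?thesis using assms(2) by (auto simp: inner_commute)
qed

lemma support_add:
  assumes "X \<noteq> {}" "bounded X"
  shows "support X (v + w) \<le> support X v + support X w"
  using inner_le_support[OF assms(2)]
  by (intro support_le assms(1)) (simp add: inner_add_right add_mono)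

lemma support_scale:
  assumes "X \<noteq> {}" "bounded X" "0 \<le> c"
  shows "support X (c *\<^sub>R v) = c * support X v"
proof (cases "c = 0")
  case True
  then show ?thesis using assms(1) by (simp add: support_def)
next
  case False
  then have c: "0 < c" using assms(3) by simp
  show ?thesis
  proof (rule antisym)
    show "support X (c *\<^sub>R v) \<le> c * support X v"
      using inner_le_support[OF assms(2), of _ v] c by (intro support_le assms(1)) simp
    have "support X v \<le> support X (c *\<^sub>R v) / c"
      using inner_le_support[OF assms(2), of _ "c *\<^sub>R v"] c
      by (intro support_le assms(1)) (simp add: field_simps)
    then show "c * support X v \<le> support X (c *\<^sub>R v)"
      using c by (simp add: field_simps)
  qed
qed

lemma continuous_on_support:
  assumes "X \<noteq> {}" "bounded X"
  shows "continuous_on UNIV (support X)"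
proof (rule convex_on_continuous[OF open_UNIV], rule convex_onI)
  fix t :: real and v w :: 'a
  assume "0 < t" "t < 1"
  then show "support X ((1 - t) *\<^sub>R v + t *\<^sub>R w) \<le> (1 - t) * support X v + t * support X w"
    using support_add[OF assms, of "(1 - t) *\<^sub>R v" "t *\<^sub>R w"] by (simp add: support_scale assms)
qed simp

lemma gap_scale:
  assumes "X \<noteq> {}" "bounded X" "0 \<le> c"
  shows "gap X (c *\<^sub>R v) x = c * gap X v x"
  using assms by (simp add: gap_def support_scale right_diff_distrib)

text \<open>
  A gap is an affine function of the point.
\<close>

lemma gap_extrapolate:
  "gap X v (y + t *\<^sub>R (y - x)) = (1 + t) * gap X v y - t * gap X v x"
  by (simp add: gap_def algebra_simps)

lemma gap_le_gap_add_dist: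
  assumes "norm v = 1"
  shows "gap X v x \<le> gap X v y + dist x y"
proof -
  have "y \<bullet> v - x \<bullet> v \<le> norm (y - x) * norm v"
    using norm_cauchy_schwarz[of "y - x" v] by (simp add: inner_diff_left)
  then show ?thesis using assms by (simp add: gap_def dist_norm norm_minus_commute)
qed

lemma le_gap:
  assumes "bounded X" "cball x r \<subseteq> X" "norm v = 1" "0 \<le> r"
  shows "r \<le> gap X v x"
proof -
  have "x + r *\<^sub>R v \<in> cball x r" using assms(3,4) by (simp add: dist_norm)
  then have "(x + r *\<^sub>R v) \<bullet> v \<le> support X v"
    using inner_le_support[OF assms(1)] assms(2) by blast
  moreover have "v \<bullet> v = 1" using assms(3) by (simp add: norm_eq_1)
  ultimately show ?thesis by (simp add: gap_def inner_add_left)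
qed

locale bounded_convex_domain =
  fixes X :: "'a::euclidean_space set"
  assumes nonempty: "X \<noteq> {}" and op: "open X" and conv: "convex X" and bdd: "bounded X"
begin

lemma gap_pos:
  assumes "x \<in> X" "v \<noteq> 0"
  shows "0 < gap X v x"
proof -
  obtain r where r: "0 < r" "cball x r \<subseteq> X"
    using op assms(1) open_contains_cball by blast
  let ?w = "(1 / norm v) *\<^sub>R v"
  have "r \<le> gap X ?w x"
    using assms(2) r by (intro le_gap bdd) auto
  also have "\<dots> = gap X v x / norm v"
    using gap_scale[OF nonempty bdd, of "1 / norm v" v x] by simp
  finally show ?thesis
    using r(1) assms(2) by (simp add: field_simps) (smt (verit) mult_pos_pos zero_less_norm_iff)
qed

lemma log_gap_scale:
  assumes "0 < c" "v \<noteq> 0" "x \<in> X" "y \<in> X"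
  shows "log_gap X (c *\<^sub>R v) x y = log_gap X v x y"
  using assms gap_pos[of x v] gap_pos[of y v]
  by (simp add: log_gap_def gap_scale nonempty bdd ln_mult)

text \<open>
  The gap is affine along the chord through \<open>x\<close>, \<open>y\<close> and \<open>p\<close>, and nonnegative at \<open>p\<close>, which
  bounds the ratio of its values at \<open>x\<close> and \<open>y\<close>. Equality holds when the gap vanishes at \<open>p\<close>, that is, for the normal of
  a supporting hyperplane at \<open>p\<close>.
\<close>

lemma chord_end_ratio:
  assumes xy: "x \<in> X" "y \<in> X" "x \<noteq> y"
  defines "p \<equiv> chord_end X x y"
  shows "0 < dist x p" "0 < dist y p"
    and "v \<noteq> 0 \<Longrightarrow> log_gap X v x y \<le> ln (dist x p / dist y p)"
    and "\<exists>v. v \<noteq> 0 \<and> log_gap X v x y = ln (dist x p / dist y p)"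
proof -
  have p: "p \<in> closure X - X" "y \<in> open_segment x p"
    unfolding p_def by (rule chord_end[OF op conv bdd xy])+
  then obtain t where t: "0 < t" "p = y + t *\<^sub>R (y - x)"
    using beyond_iff[OF xy(3)] by blast
  have "p - x = (1 + t) *\<^sub>R (y - x)" "p - y = t *\<^sub>R (y - x)"
    by (simp_all add: t(2) algebra_simps)
  then have d: "dist x p = (1 + t) * dist x y" "dist y p = t * dist x y"
    using t(1) by (simp_all add: dist_norm norm_minus_commute)
  show "0 < dist x p" "0 < dist y p"
    using d t(1) xy(3) by simp_all
  have ratio: "dist x p / dist y p = (1 + t) / t"
    using d xy(3) t(1) by simp
  have log_gap: "log_gap X v x y = ln (gap X v x / gap X v y)" if "v \<noteq> 0" for v
    using gap_pos[OF xy(1) that] gap_pos[OF xy(2) that] by (simp add: log_gap_def ln_div)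
  have gap_p: "t * gap X v x = (1 + t) * gap X v y - gap X v p" for v
    using gap_extrapolate[of X v y t x] t(2) by simp
  show "log_gap X v x y \<le> ln (dist x p / dist y p)" if "v \<noteq> 0"
  proof -
    have "0 \<le> gap X v p"
      using inner_le_support_closure[OF bdd, of p v] p(1) by (simp add: gap_def)
    then have "gap X v x / gap X v y \<le> (1 + t) / t"
      using gap_p[of v] gap_pos[OF xy(2) that] t(1) by (simp add: divide_simps mult.commute)
    then show ?thesis
      unfolding log_gap[OF that] ratio
      using gap_pos[OF xy(1) that] gap_pos[OF xy(2) that] t(1) by (subst ln_le_cancel_iff) auto
  qed
  show "\<exists>v. v \<noteq> 0 \<and> log_gap X v x y = ln (dist x p / dist y p)"
  proof -
    have "\<exists>v b. v \<noteq> 0 \<and> (\<forall>x\<in>X. v \<bullet> x \<le> b) \<and> (\<forall>x\<in>{p}. b \<le> v \<bullet> x)"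
      using p(1) nonempty by (intro separating_hyperplane_sets conv) auto
    then obtain v b where v: "v \<noteq> 0" "\<And>x. x \<in> X \<Longrightarrow> x \<bullet> v \<le> b" "b \<le> p \<bullet> v"
      by (auto simp: inner_commute)
    have "support X v \<le> p \<bullet> v"
      using support_le[OF nonempty v(2)] v(3) by simp
    then have "gap X v p = 0"
      using inner_le_support_closure[OF bdd, of p v] p(1) by (simp add: gap_def)
    then have "gap X v x / gap X v y = (1 + t) / t"
      using gap_p[of v] gap_pos[OF xy(2) v(1)] t(1) by (simp add: field_simps)
    then show ?thesis using log_gap[OF v(1)] ratio v(1) by metis
  qed
qed

lemma Hilbert_metric_eq:
  assumes "x \<in> X" "y \<in> X" "x \<noteq> y"
  shows "Hilbert_metric X x y =
    ln (dist x (chord_end X x y) / dist y (chord_end X x y)) +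
    ln (dist y (chord_end X y x) / dist x (chord_end X y x))"
  using chord_end_ratio(1,2)[OF assms] chord_end_ratio(1,2)[OF assms(2,1) assms(3)[symmetric]] assms(3)
  by (simp add: Hilbert_metric_def Let_def ln_mult ln_div)

lemma log_gap_swap: "log_gap X v y x = - log_gap X v x y"
  by (simp add: log_gap_def)

lemma log_gap_diff_le_Hilbert_metric:
  assumes "x \<in> X" "y \<in> X" "v \<noteq> 0" "w \<noteq> 0"
  shows "log_gap X v x y - log_gap X w x y \<le> Hilbert_metric X x y"
proof (cases "x = y")
  case False
  then show ?thesis
    using chord_end_ratio(3)[of x y v] chord_end_ratio(3)[of y x w] assms
      Hilbert_metric_eq[of x y] log_gap_swap[of w y x] by simp
qed (simp add: Hilbert_metric_def log_gap_def)

lemma Hilbert_metric_attained: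
  assumes "x \<in> X" "y \<in> X"
  obtains v w where "v \<noteq> 0" "w \<noteq> 0" "Hilbert_metric X x y = log_gap X v x y - log_gap X w x y"
proof (cases "x = y")
  case True
  then show ?thesis
    using that[of "SOME b. b \<in> Basis" "SOME b. b \<in> Basis"] nonzero_Basis[OF SOME_Basis]
    by (simp add: Hilbert_metric_def log_gap_def)
next
  case False
  obtain v where v: "v \<noteq> 0"
    "log_gap X v x y = ln (dist x (chord_end X x y) / dist y (chord_end X x y))"
    using chord_end_ratio(4)[OF assms False] by blast
  obtain w where w: "w \<noteq> 0"
    "log_gap X w y x = ln (dist y (chord_end X y x) / dist x (chord_end X y x))"
    using chord_end_ratio(4)[OF assms(2,1) False[symmetric]] by blast
  show ?thesis
    using that[OF v(1) w(1)] v(2) w(2) Hilbert_metric_eq[OF assms False] log_gap_swap[of w y x]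
    by simp
qed

text \<open>
  An oscillation is subadditive, and \<open>log_gap X v x z\<close> is the sum of \<open>log_gap X v x y\<close> and
  \<open>log_gap X v y z\<close>.
\<close>

lemma Hilbert_metric_triangle:
  assumes "x \<in> X" "y \<in> X" "z \<in> X"
  shows "Hilbert_metric X x z \<le> Hilbert_metric X x y + Hilbert_metric X y z"
proof -
  obtain v w where vw: "v \<noteq> 0" "w \<noteq> 0"
    "Hilbert_metric X x z = log_gap X v x z - log_gap X w x z"
    using Hilbert_metric_attained[OF assms(1,3)] .
  then show ?thesis
    using log_gap_diff_le_Hilbert_metric[OF assms(1,2) vw(1,2)]
      log_gap_diff_le_Hilbert_metric[OF assms(2,3) vw(1,2)]
    by (simp add: log_gap_def)
qed

lemma Hilbert_metric_sym:
  assumes "x \<in> X" "y \<in> X"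
  shows "Hilbert_metric X x y = Hilbert_metric X y x"
proof (cases "x = y")
  case False
  then show ?thesis
    using Hilbert_metric_eq[OF assms] Hilbert_metric_eq[OF assms(2,1)] by simp
qed simp

text \<open>
  Moving \<open>x\<close> by at most \<open>r / 2\<close> changes every gap, which is at least \<open>r\<close> at \<open>x\<close> for a unit vector,
  by at most the factor 2. The resulting bound is \<open>2 * ln 2\<close>.
\<close>

lemma Hilbert_metric_nearby:
  assumes "cball x r \<subseteq> X" "0 < r" "y \<in> X" "dist x y \<le> r / 2"
  shows "Hilbert_metric X x y \<le> 2"
proof -
  have x: "x \<in> X" using assms(1,2) by auto
  have bound: "\<bar>log_gap X v x y\<bar> \<le> ln 2" if "v \<noteq> 0" for v
  proof -
    let ?w = "(1 / norm v) *\<^sub>R v"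
    have w: "norm ?w = 1" "?w \<noteq> 0" using that by auto
    have "r \<le> gap X ?w x"
      using le_gap[OF bdd assms(1) w(1)] assms(2) by simp
    moreover have "gap X ?w x \<le> gap X ?w y + dist x y" "gap X ?w y \<le> gap X ?w x + dist x y"
      using gap_le_gap_add_dist[OF w(1), of X x y] gap_le_gap_add_dist[OF w(1), of X y x]
      by (simp_all add: dist_commute)
    ultimately have "gap X ?w x \<le> 2 * gap X ?w y" "gap X ?w y \<le> 2 * gap X ?w x"
      using assms(2,4) by linarith+
    then have "ln (gap X ?w x) \<le> ln (2 * gap X ?w y)" "ln (gap X ?w y) \<le> ln (2 * gap X ?w x)"
      using gap_pos[OF x w(2)] gap_pos[OF assms(3) w(2)] by (simp_all del: ln_mult)
    then have "\<bar>log_gap X ?w x y\<bar> \<le> ln 2"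
      using gap_pos[OF x w(2)] gap_pos[OF assms(3) w(2)] by (simp add: log_gap_def ln_mult abs_le_iff)
    then show ?thesis
      using log_gap_scale[of "1 / norm v" v x y] that x assms(3) by simp
  qed
  obtain v w where vw: "v \<noteq> 0" "w \<noteq> 0"
    "Hilbert_metric X x y = log_gap X v x y - log_gap X w x y"
    using Hilbert_metric_attained[OF x assms(3)] .
  then show ?thesis
    using bound[OF vw(1)] bound[OF vw(2)] ln_2_less_1 by linarith
qed

lemma countable_coarsely_dense:
  "\<exists>s :: nat \<Rightarrow> 'a. range s \<subseteq> X \<and> (\<forall>x\<in>X. \<exists>i. Hilbert_metric X x (s i) \<le> 2)"
proof -
  obtain T where T: "countable T" "T \<subseteq> X" "X \<subseteq> closure T"
    using separable[of X] .
  then have "T \<noteq> {}" using nonempty by auto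
  then have range: "range (from_nat_into T) = T"
    using T(1) by (rule range_from_nat_into)
  have "\<exists>i. Hilbert_metric X x (from_nat_into T i) \<le> 2" if "x \<in> X" for x
  proof -
    obtain r where r: "0 < r" "cball x r \<subseteq> X"
      using op \<open>x \<in> X\<close> open_contains_cball by blast
    have "x \<in> closure T" using T(3) \<open>x \<in> X\<close> by blast
    then obtain y where y: "y \<in> T" "dist y x < r / 2"
      using r(1) unfolding closure_approachable by (meson half_gt_zero)
    then have "Hilbert_metric X x y \<le> 2"
      using T(2) r by (intro Hilbert_metric_nearby[of x r]) (auto simp: dist_commute)
    then show ?thesis using y(1) range by (metis imageE)
  qed
  then show ?thesis
    using range T(2) by (intro exI[of _ "from_nat_into T"]) simp
qed

end

section \<open>Directions in the plane\<close>

definition dir :: "real \<Rightarrow> real ^ 2" where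
  "dir \<theta> = vector [cos \<theta>, sin \<theta>]"

lemma norm_dir: "norm (dir \<theta>) = 1"
  by (simp add: dir_def norm_eq_1 inner_vec_def sum_2 flip: power2_eq_square)

lemma dir_nonzero: "dir \<theta> \<noteq> 0"
  using norm_dir[of \<theta>] by auto

lemma dir_periodic: "dir (\<theta> + 2 * pi) = dir \<theta>"
  by (simp add: dir_def)

lemma dir_add_pi: "dir (\<theta> + pi) = - dir \<theta>"
  by (simp add: dir_def vec_eq_iff forall_2)

lemma continuous_on_dir: "continuous_on UNIV dir"
proof -
  have "continuous_on UNIV (\<lambda>\<theta>. vector [cos \<theta>, sin \<theta>] :: real ^ 2)"
    by (subst continuous_on_componentwise)
      (auto simp: Basis_vec_def inner_axis forall_2 intro!: continuous_intros)
  then show ?thesis by (simp add: dir_def[abs_def])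
qed

lemma polar_form:
  fixes v :: "real ^ 2"
  assumes "v \<noteq> 0"
  obtains \<theta> where "0 \<le> \<theta>" "v = norm v *\<^sub>R dir \<theta>"
proof -
  have "(v $ 1)\<^sup>2 + (v $ 2)\<^sup>2 = (norm v)\<^sup>2"
    unfolding power2_norm_eq_inner by (simp add: inner_vec_def sum_2 power2_eq_square)
  then have "(v $ 1 / norm v)\<^sup>2 + (v $ 2 / norm v)\<^sup>2 = 1"
    using assms by (simp add: power_divide flip: add_divide_distrib)
  then obtain t where t: "0 \<le> t" "v $ 1 / norm v = cos t" "v $ 2 / norm v = sin t"
    by (rule sincos_total_2pi)
  have "v $ 1 = norm v * cos t" "v $ 2 = norm v * sin t"
    unfolding t(2,3)[symmetric] using assms by simp_all
  then have "v = norm v *\<^sub>R dir t"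
    unfolding dir_def vec_eq_iff forall_2 by simp
  with t(1) show ?thesis by (rule that)
qed

text \<open>
  For angles \<open>\<alpha> < \<beta> < \<gamma>\<close> with \<open>\<gamma> - \<alpha> < pi\<close> all three coefficients are positive.
\<close>

lemma dir_between:
  "sin (\<gamma> - \<alpha>) *\<^sub>R dir \<beta> = sin (\<gamma> - \<beta>) *\<^sub>R dir \<alpha> + sin (\<beta> - \<alpha>) *\<^sub>R dir \<gamma>"
  by (simp add: dir_def vec_eq_iff forall_2 sin_diff algebra_simps)

text \<open>
  The vectors where a sublinear function is negative form a convex cone without antipodal pairs. It
  therefore meets the circle in an arc, and \<open>\<alpha>\<close>, \<open>\<gamma>\<close> on this arc bring \<open>\<beta>\<close> or \<open>\<delta>\<close> with them.
\<close>

lemma sublinear_no_alternation: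
  fixes S :: "real ^ 2 \<Rightarrow> real"
  assumes add: "\<And>v w. S (v + w) \<le> S v + S w"
    and scale: "\<And>c v. 0 \<le> c \<Longrightarrow> S (c *\<^sub>R v) = c * S v"
    and order: "\<alpha> < \<beta>" "\<beta> < \<gamma>" "\<gamma> < \<delta>" "\<delta> < \<alpha> + 2 * pi"
    and neg: "S (dir \<alpha>) < 0" "S (dir \<gamma>) < 0"
  shows "S (dir \<beta>) < 0 \<or> S (dir \<delta>) < 0"
proof -
  have between: "S (dir b) < 0"
    if "a < b" "b < c" "c - a < pi" "S (dir a) < 0" "S (dir c) < 0" for a b c
  proof -
    have pos: "0 < sin (c - a)" "0 < sin (c - b)" "0 < sin (b - a)"
      using that by (auto intro!: sin_gt_zero)
    have "sin (c - a) * S (dir b) = S (sin (c - b) *\<^sub>R dir a + sin (b - a) *\<^sub>R dir c)"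
      using scale[of "sin (c - a)" "dir b"] pos(1) dir_between[of c a b] by simp
    also have "\<dots> \<le> sin (c - b) * S (dir a) + sin (b - a) * S (dir c)"
      using add[of "sin (c - b) *\<^sub>R dir a" "sin (b - a) *\<^sub>R dir c"] scale pos by simp
    also have "\<dots> < 0"
      using pos that by (intro add_neg_neg mult_pos_neg)
    finally show ?thesis using pos(1) by (simp add: mult_less_0_iff)
  qed
  consider "\<gamma> - \<alpha> < pi" | "\<gamma> = \<alpha> + pi" | "pi < \<gamma> - \<alpha>" by linarith
  then show ?thesis
  proof cases
    case 1
    then show ?thesis using between[of \<alpha> \<beta> \<gamma>] order neg by simp
  next
    case 2
    have "0 = S (dir \<alpha> + dir \<gamma>)"
      using scale[of 0 0] 2 by (simp add: dir_add_pi)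
    also have "\<dots> < 0"
      using add[of "dir \<alpha>" "dir \<gamma>"] neg by linarith
    finally show ?thesis by simp
  next
    case 3
    then show ?thesis
      using between[of \<gamma> \<delta> "\<alpha> + 2 * pi"] order neg by (simp add: dir_periodic)
  qed
qed

definition grid :: "nat \<Rightarrow> nat \<Rightarrow> real" where
  "grid n i = 2 * pi * real i / real (Suc n)"

lemma grid_approx:
  assumes "0 \<le> \<theta>"
  obtains a where "(\<lambda>n. grid n (a n)) \<longlonglongrightarrow> \<theta>"
proof
  \<comment> \<open>The last grid angle that does not exceed \<open>\<theta>\<close>.\<close>
  define a where "a n = nat \<lfloor>\<theta> * real (Suc n) / (2 * pi)\<rfloor>" for n
  have a: "real (a n) \<le> \<theta> * real (Suc n) / (2 * pi)" "\<theta> * real (Suc n) / (2 * pi) < real (a n) + 1" for n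
  proof -
    have "0 \<le> \<theta> * real (Suc n) / (2 * pi)" using assms by simp
    then show "real (a n) \<le> \<theta> * real (Suc n) / (2 * pi)" "\<theta> * real (Suc n) / (2 * pi) < real (a n) + 1"
      unfolding a_def by (simp_all del: of_nat_Suc)
  qed
  have "(\<lambda>n. \<theta> - 2 * pi * (1 / real (Suc n))) \<longlonglongrightarrow> \<theta> - 2 * pi * 0"
    by (intro tendsto_intros LIMSEQ_Suc[OF lim_1_over_n])
  then have low: "(\<lambda>n. \<theta> - 2 * pi * (1 / real (Suc n))) \<longlonglongrightarrow> \<theta>" by simp
  show "(\<lambda>n. grid n (a n)) \<longlonglongrightarrow> \<theta>"
  proof (rule tendsto_sandwich[OF _ _ low tendsto_const])
    show "\<forall>\<^sub>F n in sequentially. \<theta> - 2 * pi * (1 / real (Suc n)) \<le> grid n (a n)"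
    proof (rule always_eventually, rule allI)
      fix n
      have "\<theta> \<le> (2 * pi * real (a n) + 2 * pi) / real (Suc n)"
        using a(2)[of n] by (simp add: pos_le_divide_eq pos_divide_less_eq algebra_simps del: of_nat_Suc)
      then show "\<theta> - 2 * pi * (1 / real (Suc n)) \<le> grid n (a n)"
        by (simp add: grid_def add_divide_distrib del: of_nat_Suc)
    qed
    show "\<forall>\<^sub>F n in sequentially. grid n (a n) \<le> \<theta>"
    proof (rule always_eventually, rule allI)
      show "grid n (a n) \<le> \<theta>" for n
        using a(1)[of n] by (simp add: grid_def field_simps del: of_nat_Suc)
    qed
  qed
qed

section \<open>The Hilbert metric of a planar domain as a total variation\<close>

locale plane_domain = bounded_convex_domain X for X :: "(real ^ 2) set"
begin

text \<open>
  Comparing \<open>log_gap\<close> with \<open>c\<close> means looking at the sign of \<open>S v = gap X v x - k * gap X v y\<close> with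
  \<open>k = exp c\<close>. This is \<open>(1 - k) * support X v\<close> plus a linear function, so \<open>S\<close> is sublinear for
  \<open>k \<le> 1\<close> and \<open>- S\<close> is sublinear for \<open>k \<ge> 1\<close>. Either way its alternation is impossible.
\<close>

lemma log_gap_no_alternation:
  assumes xy: "x \<in> X" "y \<in> X"
    and order: "\<alpha> < \<beta>" "\<beta> < \<gamma>" "\<gamma> < \<delta>" "\<delta> < \<alpha> + 2 * pi"
    and alt: "log_gap X (dir \<alpha>) x y > c" "log_gap X (dir \<beta>) x y < c" "log_gap X (dir \<gamma>) x y > c"
  shows "log_gap X (dir \<delta>) x y \<ge> c"
proof (rule ccontr)
  assume "\<not> log_gap X (dir \<delta>) x y \<ge> c"
  then have \<delta>: "log_gap X (dir \<delta>) x y < c" by simp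
  define k where "k = exp c"
  define S where "S v = gap X v x - k * gap X v y" for v
  have S: "S v = (1 - k) * support X v - (x - k *\<^sub>R y) \<bullet> v" for v
    by (simp add: S_def gap_def algebra_simps)
  have log_gap: "log_gap X (dir \<theta>) x y = ln (gap X (dir \<theta>) x / gap X (dir \<theta>) y)" for \<theta>
    using gap_pos[OF xy(1) dir_nonzero[of \<theta>]] gap_pos[OF xy(2) dir_nonzero[of \<theta>]]
    by (simp add: log_gap_def ln_div)
  have pos: "0 < gap X (dir \<theta>) x / gap X (dir \<theta>) y" for \<theta>
    using gap_pos[OF xy(1) dir_nonzero[of \<theta>]] gap_pos[OF xy(2) dir_nonzero[of \<theta>]] by simp
  have gt: "log_gap X (dir \<theta>) x y > c \<longleftrightarrow> S (dir \<theta>) > 0" for \<theta>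
    using gap_pos[OF xy(2) dir_nonzero, of \<theta>] ln_less_cancel_iff[OF exp_gt_zero pos[of \<theta>], of c]
    unfolding log_gap S_def k_def by (simp add: field_simps)
  have lt: "log_gap X (dir \<theta>) x y < c \<longleftrightarrow> S (dir \<theta>) < 0" for \<theta>
    using gap_pos[OF xy(2) dir_nonzero, of \<theta>] ln_less_cancel_iff[OF pos[of \<theta>] exp_gt_zero, of c]
    unfolding log_gap S_def k_def by (simp add: field_simps)
  have scale: "S (r *\<^sub>R v) = r * S v" if "0 \<le> r" for r v
    using that by (simp add: S_def gap_scale nonempty bdd right_diff_distrib)
  show False
  proof (cases "k \<le> 1")
    case True
    have "S (v + w) \<le> S v + S w" for v w
      using mult_left_mono[OF support_add[OF nonempty bdd, of v w], of "1 - k"] True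
      unfolding S by (simp add: algebra_simps)
    \<comment> \<open>The pattern is used from \<open>\<beta>\<close> on, closing up with \<open>\<alpha>\<close> one turn later.\<close>
    then have "S (dir \<gamma>) < 0 \<or> S (dir (\<alpha> + 2 * pi)) < 0"
      using scale order alt(2) \<delta> lt by (intro sublinear_no_alternation[where \<alpha> = \<beta> and \<gamma> = \<delta>]) auto
    then show False using alt(1,3) gt by (auto simp: dir_periodic)
  next
    case False
    have "- S (v + w) \<le> - S v + - S w" for v w
      using mult_left_mono[OF support_add[OF nonempty bdd, of v w], of "k - 1"] False
      unfolding S by (simp add: algebra_simps)
    then have "- S (dir \<beta>) < 0 \<or> - S (dir \<delta>) < 0"
      using scale order alt(1,3) gt
      by (intro sublinear_no_alternation[where S = "\<lambda>v. - S v" and \<alpha> = \<alpha> and \<gamma> = \<gamma>]) auto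
    then show False using alt(2) \<delta> lt by auto
  qed
qed

lemma isCont_log_gap_dir:
  assumes "x \<in> X" "y \<in> X"
  shows "isCont (\<lambda>\<theta>. log_gap X (dir \<theta>) x y) \<theta>"
proof -
  have "continuous_on UNIV (\<lambda>\<theta>. support X (dir \<theta>))"
    by (rule continuous_on_compose2[OF continuous_on_support[OF nonempty bdd] continuous_on_dir]) simp
  then have "continuous_on UNIV (\<lambda>\<theta>. log_gap X (dir \<theta>) x y)"
    using gap_pos[OF assms(1) dir_nonzero] gap_pos[OF assms(2) dir_nonzero]
    unfolding log_gap_def gap_def
    by (intro continuous_intros continuous_on_dir) (auto simp: less_le)
  then show ?thesis by (simp add: continuous_on_eq_continuous_at)
qed

definition grid_variation :: "nat \<Rightarrow> real ^ 2 \<Rightarrow> real ^ 2 \<Rightarrow> real" where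
  "grid_variation n x y =
     (\<Sum>i<Suc n. \<bar>log_gap X (dir (grid n (Suc i))) x y - log_gap X (dir (grid n i)) x y\<bar>)"

lemma grid_variation_eq:
  assumes "x \<in> X" "y \<in> X"
  obtains p q where
    "\<And>i. log_gap X (dir (grid n i)) x y \<le> log_gap X (dir (grid n p)) x y"
    "\<And>i. log_gap X (dir (grid n q)) x y \<le> log_gap X (dir (grid n i)) x y"
    "grid_variation n x y = 2 * (log_gap X (dir (grid n p)) x y - log_gap X (dir (grid n q)) x y)"
proof -
  define u where "u i = log_gap X (dir (grid n i)) x y" for i
  have shift: "grid n (i + Suc n) = grid n i + 2 * pi" for i
    by (simp add: grid_def field_simps)
  have mono: "grid n i < grid n j" if "i < j" for i j
    using that by (simp add: grid_def divide_strict_right_mono del: of_nat_Suc)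
  have "u l \<ge> c"
    if "i < j" "j < k" "k < l" "l < i + Suc n" "u i > c" "u j < c" "u k > c" for i j k l c
    using log_gap_no_alternation[OF assms mono[OF that(1)] mono[OF that(2)] mono[OF that(3)]]
      mono[OF that(4)] that(5-) unfolding shift u_def by blast
  moreover have "u (i + Suc n) = u i" for i
    unfolding u_def shift dir_periodic ..
  ultimately obtain p q where "\<And>i. u i \<le> u p" "\<And>i. u q \<le> u i"
    "(\<Sum>i<Suc n. \<bar>u (Suc i) - u i\<bar>) = 2 * (u p - u q)"
    using cyclic_variation[of "Suc n" u] by blast
  then show ?thesis
    using that unfolding grid_variation_def u_def by blast
qed

lemma grid_variation_tendsto:
  assumes "x \<in> X" "y \<in> X"
  shows "(\<lambda>n. grid_variation n x y) \<longlonglongrightarrow> 2 * Hilbert_metric X x y"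
proof -
  define u where "u \<theta> = log_gap X (dir \<theta>) x y" for \<theta>
  obtain v w where vw: "v \<noteq> 0" "w \<noteq> 0"
    "Hilbert_metric X x y = log_gap X v x y - log_gap X w x y"
    using Hilbert_metric_attained[OF assms] .
  have log_gap_polar: "log_gap X v x y = u \<theta>" if "v \<noteq> 0" "v = norm v *\<^sub>R dir \<theta>" for v \<theta>
  proof -
    have "log_gap X v x y = log_gap X (norm v *\<^sub>R dir \<theta>) x y"
      by (rule arg_cong[OF that(2)])
    then show ?thesis
      using log_gap_scale[OF _ dir_nonzero assms, of "norm v"] that(1) by (simp add: u_def)
  qed
  obtain \<theta> where \<theta>: "0 \<le> \<theta>" "v = norm v *\<^sub>R dir \<theta>"
    using polar_form[OF vw(1)] .
  obtain \<phi> where \<phi>: "0 \<le> \<phi>" "w = norm w *\<^sub>R dir \<phi>"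
    using polar_form[OF vw(2)] .
  have eq: "Hilbert_metric X x y = u \<theta> - u \<phi>"
    using vw log_gap_polar[OF vw(1) \<theta>(2)] log_gap_polar[OF vw(2) \<phi>(2)] by simp
  obtain a where a: "(\<lambda>n. grid n (a n)) \<longlonglongrightarrow> \<theta>"
    using grid_approx[OF \<theta>(1)] .
  obtain b where b: "(\<lambda>n. grid n (b n)) \<longlonglongrightarrow> \<phi>"
    using grid_approx[OF \<phi>(1)] .
  have cont: "isCont u \<psi>" for \<psi>
    unfolding u_def by (rule isCont_log_gap_dir[OF assms])
  have "(\<lambda>n. 2 * (u (grid n (a n)) - u (grid n (b n)))) \<longlonglongrightarrow> 2 * (u \<theta> - u \<phi>)"
    by (intro tendsto_intros isCont_tendsto_compose[OF cont] a b)
  then have low: "(\<lambda>n. 2 * (u (grid n (a n)) - u (grid n (b n)))) \<longlonglongrightarrow> 2 * Hilbert_metric X x y"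
    by (simp add: eq)
  have bounds: "2 * (u (grid n i) - u (grid n j)) \<le> grid_variation n x y"
    "grid_variation n x y \<le> 2 * Hilbert_metric X x y" for n i j
  proof -
    obtain p q where pq: "\<And>i. u (grid n i) \<le> u (grid n p)" "\<And>i. u (grid n q) \<le> u (grid n i)"
      "grid_variation n x y = 2 * (u (grid n p) - u (grid n q))"
      unfolding u_def by (rule grid_variation_eq[OF assms, of n]) blast
    show "2 * (u (grid n i) - u (grid n j)) \<le> grid_variation n x y"
      using pq(1)[of i] pq(2)[of j] pq(3) by simp
    show "grid_variation n x y \<le> 2 * Hilbert_metric X x y"
      using pq(3) log_gap_diff_le_Hilbert_metric[OF assms dir_nonzero[of "grid n p"] dir_nonzero[of "grid n q"]]
      by (simp add: u_def)
  qed
  show ?thesis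
    by (rule tendsto_sandwich[OF _ _ low tendsto_const]) (rule always_eventually, rule allI, rule bounds)+
qed

end


section \<open>Embedding into \<open>\<ell>\<^sup>2\<close>\<close>

context plane_domain
begin

text \<open>
  The points are given as a family \<open>s\<close>, possibly with repetitions, so that positive
  semidefiniteness is only needed for kernels on a whole type.
\<close>

lemma psd_Hilbert_metric:
  assumes s: "\<And>i. s i \<in> X" and z: "z \<in> X"
  shows "psd (\<lambda>i j. Hilbert_metric X (s i) z + Hilbert_metric X (s j) z - Hilbert_metric X (s i) (s j))"
proof -
  have "psd (\<lambda>i j. grid_variation n (s i) z + grid_variation n (s j) z - grid_variation n (s i) (s j))" for n
  proof -
    define \<psi> where "\<psi> m x = ln (gap X (dir (grid n (Suc m))) x) - ln (gap X (dir (grid n m)) x)" for m x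
    have "grid_variation n x y = (\<Sum>m<Suc n. \<bar>\<psi> m x - \<psi> m y\<bar>)" for x y
      unfolding grid_variation_def log_gap_def \<psi>_def by (intro sum.cong refl) (simp add: algebra_simps)
    then have "grid_variation n x z + grid_variation n y z - grid_variation n x y
        = (\<Sum>m<Suc n. \<bar>\<psi> m x - \<psi> m z\<bar> + \<bar>\<psi> m y - \<psi> m z\<bar> - \<bar>\<psi> m x - \<psi> m y\<bar>)" for x y
      by (simp only: sum.distrib sum_subtractf)
    then show ?thesis
      by (simp add: psd_sum psd_abs_diff del: sum.lessThan_Suc)
  qed
  moreover have "(\<lambda>n. grid_variation n (s i) z + grid_variation n (s j) z - grid_variation n (s i) (s j))
      \<longlonglongrightarrow> 2 * Hilbert_metric X (s i) z + 2 * Hilbert_metric X (s j) z - 2 * Hilbert_metric X (s i) (s j)" for i j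
    by (intro tendsto_intros grid_variation_tendsto s z)
  ultimately have "psd (\<lambda>i j. 2 * Hilbert_metric X (s i) z + 2 * Hilbert_metric X (s j) z - 2 * Hilbert_metric X (s i) (s j))"
    by (rule psd_limit)
  from psd_scale[OF this, of "1 / 2"] show ?thesis
    by (simp add: algebra_simps add_divide_distrib diff_divide_distrib)
qed

text \<open>
  With \<open>s 0\<close> as the origin, half of the kernel of \<open>psd_Hilbert_metric\<close> is the Gram matrix to be
  realised.
\<close>

lemma sqrt_Hilbert_metric_embedding:
  fixes s :: "nat \<Rightarrow> real ^ 2"
  assumes s: "\<And>i. s i \<in> X"
  shows "\<exists>G :: nat \<Rightarrow> ell2. \<forall>i j. (norm (G i - G j))\<^sup>2 = Hilbert_metric X (s i) (s j)"
proof -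
  let ?d = "Hilbert_metric X"
  have "psd (\<lambda>i j. 1 / 2 * (?d (s i) (s 0) + ?d (s j) (s 0) - ?d (s i) (s j)))"
    by (intro psd_scale psd_Hilbert_metric s) simp
  from psd_gram[OF this] obtain G :: "nat \<Rightarrow> ell2" where G: "\<forall>i j. (norm (G i - G j))\<^sup>2 =
      1 / 2 * (?d (s i) (s 0) + ?d (s i) (s 0) - ?d (s i) (s i)) +
      1 / 2 * (?d (s j) (s 0) + ?d (s j) (s 0) - ?d (s j) (s j)) -
      2 * (1 / 2 * (?d (s i) (s 0) + ?d (s j) (s 0) - ?d (s i) (s j)))" ..
  have "?d x x = 0" for x by (simp add: Hilbert_metric_def)
  then have "(norm (G i - G j))\<^sup>2 = ?d (s i) (s j)" for i j
    using G[rule_format, of i j] by (simp add: field_simps)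
  then show ?thesis by blast
qed

end

theorem mainTheorem5:
  fixes X :: "(real ^ 2) set"
  assumes "X \<noteq> {}" and "open X" and "convex X" and "bounded X"
  shows "\<exists>F :: real ^ 2 \<Rightarrow> ell2. coarse_embedding X (Hilbert_metric X) F"
proof -
  interpret plane_domain X
    by unfold_locales (use assms in auto)
  let ?d = "Hilbert_metric X"
  obtain s :: "nat \<Rightarrow> real ^ 2" where s: "range s \<subseteq> X" "\<forall>x\<in>X. \<exists>i. ?d x (s i) \<le> 2"
    using countable_coarsely_dense by blast
  have sX: "s i \<in> X" for i using s(1) by blast
  obtain G :: "nat \<Rightarrow> ell2" where G: "\<forall>i j. (norm (G i - G j))\<^sup>2 = ?d (s i) (s j)"
    using sqrt_Hilbert_metric_embedding[of s, OF sX] by blast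
  obtain \<iota> where \<iota>: "\<forall>x\<in>X. ?d x (s (\<iota> x)) \<le> 2"
    using bchoice[OF s(2)] by blast
  \<comment> \<open>Each of the two points is moved by at most 2.\<close>
  have close: "\<bar>(norm (G (\<iota> x) - G (\<iota> y)))\<^sup>2 - ?d x y\<bar> \<le> 4" if "x \<in> X" "y \<in> X" for x y
  proof -
    let ?x = "s (\<iota> x)" and ?y = "s (\<iota> y)"
    have "?d x y \<le> ?d x ?x + ?d ?x y" "?d ?x y \<le> ?d ?x ?y + ?d ?y y"
      "?d ?x ?y \<le> ?d ?x x + ?d x ?y" "?d x ?y \<le> ?d x y + ?d y ?y"
      by (intro Hilbert_metric_triangle that sX)+
    moreover have "?d ?x x = ?d x ?x" "?d ?y y = ?d y ?y"
      by (rule Hilbert_metric_sym[OF sX that(1)], rule Hilbert_metric_sym[OF sX that(2)])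
    ultimately show ?thesis
      unfolding G[rule_format] abs_le_iff using \<iota>[rule_format, OF that(1)] \<iota>[rule_format, OF that(2)]
      by linarith
  qed
  have "coarse_embedding X ?d (\<lambda>x. G (\<iota> x))"
    unfolding coarse_embedding_def
  proof (intro exI conjI ballI)
    show "(\<lambda>t::real. sqrt (max 0 (t - 4))) \<in> {0..} \<rightarrow> {0..}" "(\<lambda>t::real. sqrt (t + 4)) \<in> {0..} \<rightarrow> {0..}"
      by auto
    show "mono_on {0..} (\<lambda>t::real. sqrt (max 0 (t - 4)))" "mono_on {0..} (\<lambda>t::real. sqrt (t + 4))"
      by (auto intro!: mono_onI)
    have "filterlim (\<lambda>t::real. t - 4) at_top at_top"
      using filterlim_tendsto_add_at_top[OF tendsto_const[of "- 4 :: real"] filterlim_ident] by simp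
    then have "filterlim (\<lambda>t::real. max 0 (t - 4)) at_top at_top"
      by (rule filterlim_at_top_mono) simp
    then show "filterlim (\<lambda>t::real. sqrt (max 0 (t - 4))) at_top at_top"
      by (rule filterlim_compose[OF sqrt_at_top])
    fix x y assume "x \<in> X" "y \<in> X"
    note c = close[OF this]
    show "sqrt (max 0 (?d x y - 4)) \<le> norm (G (\<iota> x) - G (\<iota> y))"
      using c by (intro real_le_lsqrt) (auto simp: abs_le_iff)
    show "norm (G (\<iota> x) - G (\<iota> y)) \<le> sqrt (?d x y + 4)"
      using c by (intro real_le_rsqrt) (auto simp: abs_le_iff)
  qed
  then show ?thesis by (rule exI[of _ "\<lambda>x. G (\<iota> x)"])
qed

end
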